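(* For every integer $n\ge0$, the cardinality of the set $\mathrm{NCL}(n+1)$ of noncrossing linked partitions of $\{1,\ldots,n+1\}$ is the large Schr\"oder number $r_n$.
   Context: For $E,F\subseteq\{1,\ldots,n\}$: $E$ and $F$ are crossing if there exist $i_1,i_2\in E$ and $j_1,j_2\in F$ with $i_1<j_1<i_2<j_2$; for distinct blocks, "noncrossing" means that no such pattern occurs, with the roles of $E$ and $F$ taken in either order. $E$ and $F$ are nearly disjoint if for every $i\in E\cap F$ one of the following holds: (a) $i=\min(E)$, $|E|>1$ and $i\ne\min(F)$; (b) $i\ne\min(E)$, $i=\min(F)$ and $|F|>1$. A set $\pi$ of nonempty subsets of $\{1,\ldots,n\}$ is a noncrossing linked partition of $\{1,\ldots,n\}$ if the union of $\pi$ is all of $\{1,\ldots,n\}$ and any two distinct elements of $\pi$ are noncrossing and nearly disjoint. $\mathrm{NCL}(n)$ is the set of all noncrossing linked partitions of $\{1,\ldots,n\}$. The large Schr\"oder numbers $(r_n)_{n\ge0}=(1,2,6,22,90,394,\ldots)$ have generating function $\sum_{n\ge0}r_nw^n=\dfrac{1-w-\sqrt{1-6w+w^2}}{2w}$; equivalently $r_n$ is the number of lattice paths from $(0,0)$ to $(n,n)$ with steps $(1,0),(0,1),(1,1)$ that never rise above the diagonal. *)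

theory Defs
  imports Complex_Main "HOL-Computational_Algebra.Computational_Algebra"
begin

definition crossing :: "nat set \<Rightarrow> nat set \<Rightarrow> bool" where
  "crossing E F \<longleftrightarrow>
     (\<exists>i1\<in>E. \<exists>i2\<in>E. \<exists>j1\<in>F. \<exists>j2\<in>F. i1 < j1 \<and> j1 < i2 \<and> i2 < j2)"

text \<open>The relation \<^const>\<open>crossing\<close> is not symmetric; noncrossing excludes the pattern in
  either order.\<close>

definition noncrossing :: "nat set \<Rightarrow> nat set \<Rightarrow> bool" where
  "noncrossing E F \<longleftrightarrow> \<not> crossing E F \<and> \<not> crossing F E"

definition nearly_disjoint :: "nat set \<Rightarrow> nat set \<Rightarrow> bool" where
  "nearly_disjoint E F \<longleftrightarrow>
     (\<forall>i\<in>E \<inter> F. (i = Min E \<and> card E > 1 \<and> i \<noteq> Min F) \<or>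
                 (i \<noteq> Min E \<and> i = Min F \<and> card F > 1))"

definition NCL :: "nat \<Rightarrow> nat set set set" where
  "NCL n = {\<pi>. (\<forall>E\<in>\<pi>. E \<noteq> {} \<and> E \<subseteq> {1..n}) \<and> \<Union>\<pi> = {1..n} \<and>
                (\<forall>E\<in>\<pi>. \<forall>F\<in>\<pi>. E \<noteq> F \<longrightarrow> noncrossing E F \<and> nearly_disjoint E F)}"

text \<open>The square root is the formal power series with constant coefficient \<open>1\<close>. The numerator
  below has constant coefficient \<open>0\<close>, so the quotient by \<open>2w\<close> is an exact division of power
  series.\<close>

definition schroeder_gf :: "real fps" where
  "schroeder_gf =
     (1 - fps_X - fps_radical (\<lambda>_. sqrt) 2 (1 - 6 * fps_X + fps_X ^ 2)) / (2 * fps_X)"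

definition large_schroeder :: "nat \<Rightarrow> real" where
  "large_schroeder n = fps_nth schroeder_gf n"

end

theory Submission
  imports Defs
begin

text \<open>
  A linked partition is a forest in disguise. Near disjointness implies that every element lies in
  at most one block of which it is not the minimum, that different blocks have different minima,
  and that a singleton block meets no other block. Sending each \<open>j\<close> to the minimum of the block
  in which it is not minimal, or to \<open>0\<close> if there is no such block, therefore loses no information,
  and the partition is noncrossing exactly when no two arcs of this parent function \<open>p\<close> cross, where
  the arcs are the pairs \<open>(p j, j)\<close> with \<open>p j > 0\<close>
  (\<open>bij_betw_blocks_of\<close>).

  Such parent functions can be written down from left to right. The only thing that matters for
  the future is the number of vertices that are not yet enclosed by an arc: if there are \<open>k\<close> of them,
  the next vertex may become a root, which leaves \<open>k + 1\<close>, or it may be attached to the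
  \<open>t\<close>-th of them, which encloses all later ones and leaves \<open>t + 1\<close>, where \<open>1 \<le> t \<le> k\<close>.
  This is the classical generating tree of the large Schroeder numbers.

  If \<open>S\<close> is the Schroeder series, then \<open>S = 1 + X S + X S\<^sup>2\<close>, and this equation implies that the series
  \<open>S ((1 + S)/2)\<^sup>a\<close> satisfy the recurrence of the tree for \<open>k = a + 1\<close>
  (\<open>completion_gf_recurrence\<close>). They hence count the completions of a beginning with \<open>a + 1\<close> open
  vertices (\<open>card_completions\<close>). The beginning that consists of the vertex \<open>1\<close> alone has
  \<open>a = 0\<close>, and its completions are counted by \<open>S\<close>.
\<close>

section \<open>The functional equation of the Schroeder series\<close>

lemma schroeder_gf_equation:
  "schroeder_gf = 1 + fps_X * schroeder_gf + fps_X * schroeder_gf ^ 2"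
proof -
  define R where "R = fps_radical (\<lambda>_. sqrt) 2 (1 - 6 * fps_X + fps_X ^ 2 :: real fps)"
  define Q :: "real fps" where "Q = 1 - 6 * fps_X + fps_X ^ 2"
  define S where "S = schroeder_gf"
  have Q0: "fps_nth Q 0 = 1"
    by (simp add: Q_def power2_eq_square fps_mult_nth)
  have R2: "R ^ 2 = Q"
    using power_radical[of Q "\<lambda>_. sqrt" 1] Q0
    by (simp add: R_def Q_def numeral_2_eq_2)
  have R0: "fps_nth R 0 = 1"
    using Q0 unfolding R_def Q_def by simp
  have "2 * fps_X dvd (1 - fps_X - R)"
  proof -
    have "fps_X * fps_shift 1 (1 - fps_X - R) = 1 - fps_X - R"
      by (intro fps_ext) (auto simp: R0)
    then have "1 - fps_X - R = 2 * fps_X * (fps_const (1/2) * fps_shift 1 (1 - fps_X - R))"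
      by (simp add: numeral_fps_const mult.assoc mult.left_commute[of fps_X])
    then show ?thesis by (rule dvdI)
  qed
  then have "2 * fps_X * S = 1 - fps_X - R"
    unfolding S_def schroeder_gf_def R_def by (rule dvd_mult_div_cancel)
  then have "R = 1 - fps_X - 2 * fps_X * S"
    by (simp add: algebra_simps)
  with R2 have "(1 - fps_X - 2 * fps_X * S) ^ 2 = 1 - 6 * fps_X + fps_X ^ 2"
    by (simp add: Q_def)
  then have "(4 * fps_X) * S = (4 * fps_X) * (1 + fps_X * S + fps_X * S ^ 2)"
    by algebra
  then show ?thesis
    unfolding S_def[symmetric] by (subst (asm) mult_cancel_left) simp
qed

definition completion_gf :: "nat \<Rightarrow> real fps" where
  "completion_gf a = schroeder_gf * (fps_const (1/2) * (1 + schroeder_gf)) ^ a"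

text \<open>
  The difference of two consecutive instances is a two-term recurrence with constant coefficients,
  whose characteristic equation \<open>2 X \<lambda>\<^sup>2 - (1 + X) \<lambda> + 1 = 0\<close> has the root
  \<open>\<lambda> = (1 + S)/2\<close>; this is where the geometric form of the series comes from.
\<close>

lemma completion_gf_recurrence:
  "completion_gf a =
     1 + fps_X * (completion_gf (Suc a) + (\<Sum>t = 1..Suc a. completion_gf t))"
proof -
  define S where "S = schroeder_gf"
  define L where "L = fps_const (1/2) * (1 + S)"
  have S: "S = 1 + fps_X * S + fps_X * S ^ 2"
    unfolding S_def by (rule schroeder_gf_equation)
  have L: "2 * L = 1 + S"
    by (simp add: L_def numeral_fps_const flip: mult.assoc)
  have G: "completion_gf b = S * L ^ b" for b
    by (simp add: completion_gf_def S_def L_def)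
  have "2 * (L - 1 - fps_X * (2 * L ^ 2 - L)) = 0"
    using S L by algebra
  moreover have "(2 :: real fps) \<noteq> 0"
    by (simp add: numeral_fps_const)
  ultimately have char_eq: "L - 1 = fps_X * (2 * L ^ 2 - L)"
    by (metis mult_eq_0_iff right_minus_eq)
  show ?thesis
  proof (induction a)
    case 0
    have "S = 1 + fps_X * (S * (2 * L))"
      using S L by algebra
    then show ?case
      by (simp add: G algebra_simps)
  next
    case (Suc a)
    let ?s = "\<Sum>t = 1..Suc a. S * L ^ t"
    have IH: "S * L ^ a = 1 + fps_X * (S * L ^ Suc a + ?s)"
      using Suc.IH by (simp only: G)
    have "S * L ^ Suc a - S * L ^ a = S * L ^ a * (L - 1)"
      by (simp add: algebra_simps)
    also have "\<dots> = fps_X * (2 * (S * L ^ Suc (Suc a)) - S * L ^ Suc a)"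
      by (simp add: char_eq algebra_simps power2_eq_square)
    finally have step: "S * L ^ Suc a - S * L ^ a
        = fps_X * (2 * (S * L ^ Suc (Suc a)) - S * L ^ Suc a)" .
    have "y = 1 + fps_X * (z + (s + z))"
      if "y - x = fps_X * (2 * z - y)" "x = 1 + fps_X * (y + s)" for x y z s :: "real fps"
      using that by algebra
    from this[OF step IH] have "S * L ^ Suc a
        = 1 + fps_X * (S * L ^ Suc (Suc a) + (?s + S * L ^ Suc (Suc a)))" .
    then show ?case
      by (simp add: G)
  qed
qed

lemma completion_gf_nth_0: "fps_nth (completion_gf a) 0 = 1"
  by (subst completion_gf_recurrence) simp

lemma completion_gf_nth_Suc:
  "fps_nth (completion_gf a) (Suc m) =
     fps_nth (completion_gf (Suc a)) m + (\<Sum>t = 1..Suc a. fps_nth (completion_gf t) m)"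
  by (subst completion_gf_recurrence) (simp add: fps_sum_nth del: sum.cl_ivl_Suc)

section \<open>Noncrossing linked partitions as parent functions\<close>

text \<open>
  Since the vertices are positive, \<open>0\<close> can mark the vertices without a parent. All values outside
  \<open>{1..n}\<close> are \<open>0\<close>, so that a function is determined by its restriction to \<open>{1..n}\<close>.
\<close>

definition parent_funs :: "nat \<Rightarrow> (nat \<Rightarrow> nat) set" where
  "parent_funs n = {p. (\<forall>j. p j = 0 \<or> p j < j) \<and> (\<forall>j>n. p j = 0) \<and>
                       (\<forall>i j. \<not> (0 < p i \<and> p i < p j \<and> p j < i \<and> i < j))}"

definition block :: "(nat \<Rightarrow> nat) \<Rightarrow> nat \<Rightarrow> nat set" where
  "block p m = insert m {j. p j = m}"

text \<open>
  A leaf that has a parent must not contribute its own block: that block would be a singleton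
  contained in the block of the parent, contrary to near disjointness.
\<close>

definition blocks_of :: "nat \<Rightarrow> (nat \<Rightarrow> nat) \<Rightarrow> nat set set" where
  "blocks_of n p = block p ` {m \<in> {1..n}. p m = 0 \<or> (\<exists>j. p j = m)}"

lemma parent_fun_less: "p \<in> parent_funs n \<Longrightarrow> p j > 0 \<Longrightarrow> p j < j"
  by (force simp: parent_funs_def)

lemma parent_fun_support: "p \<in> parent_funs n \<Longrightarrow> p j > 0 \<Longrightarrow> j \<le> n"
  by (metis (mono_tags, lifting) leI less_numeral_extra(3) mem_Collect_eq parent_funs_def)

lemma parent_fun_noncrossing:
  "p \<in> parent_funs n \<Longrightarrow> 0 < p i \<Longrightarrow> p i < p j \<Longrightarrow> p j < i \<Longrightarrow> i < j \<Longrightarrow> False"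
  unfolding parent_funs_def by blast

context
  fixes n p
  assumes p: "p \<in> parent_funs n"
begin

lemma block_subset:
  assumes "m \<in> {1..n}"
  shows "block p m \<subseteq> {1..n}"
proof
  fix j assume "j \<in> block p m"
  then show "j \<in> {1..n}"
    using assms parent_fun_less[OF p, of j] parent_fun_support[OF p, of j]
    by (auto simp: block_def)
qed

lemma Min_block:
  assumes "m \<in> {1..n}"
  shows "Min (block p m) = m"
proof (rule Min_eqI)
  show "finite (block p m)"
    using block_subset[OF assms] finite_subset by blast
  show "m \<le> y" if "y \<in> block p m" for y
    using that assms parent_fun_less[OF p, of y] by (auto simp: block_def)
qed (simp add: block_def)

lemma card_block_gt_1:
  assumes "m \<in> {1..n}" "p j = m"
  shows "card (block p m) > 1"
proof -
  have "j \<noteq> m" "{m, j} \<subseteq> block p m"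
    using assms parent_fun_less[OF p, of j] by (auto simp: block_def)
  moreover have "finite (block p m)"
    using block_subset[OF assms(1)] finite_subset by blast
  ultimately show ?thesis
    using card_mono[of "block p m" "{m, j}"] by simp
qed

text \<open>
  Whichever of the two minima is smaller, replacing suitable elements of a crossing pattern by the
  minima of their blocks turns it into a pair of crossing arcs.
\<close>

lemma not_crossing_blocks:
  assumes "a \<in> {1..n}" "b \<in> {1..n}" "a \<noteq> b"
  shows "\<not> crossing (block p a) (block p b)"
proof
  assume "crossing (block p a) (block p b)"
  then obtain i1 i2 j1 j2 where *: "i1 \<in> block p a" "i2 \<in> block p a"
    "j1 \<in> block p b" "j2 \<in> block p b" "i1 < j1" "j1 < i2" "i2 < j2"
    unfolding crossing_def by blast
  have le: "a \<le> i" if "i \<in> block p a" for i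
    using that assms parent_fun_less[OF p, of i] by (auto simp: block_def)
  have le': "b \<le> i" if "i \<in> block p b" for i
    using that assms parent_fun_less[OF p, of i] by (auto simp: block_def)
  have "p i2 = a" "p j2 = b"
    using * le[of i1] le'[of j1] by (auto simp: block_def)
  show False
  proof (cases "a < b")
    case True
    then show False
      using parent_fun_noncrossing[OF p, of i2 j2] * le'[of j1] assms
        \<open>p i2 = a\<close> \<open>p j2 = b\<close> by auto
  next
    case False
    with assms have "b < a" by simp
    with * le[of i1] have "p j1 = b"
      by (auto simp: block_def)
    with \<open>b < a\<close> show False
      using parent_fun_noncrossing[OF p, of j1 i2] * le[of i1] assms \<open>p i2 = a\<close> by auto
  qed
qed

lemma nearly_disjoint_blocks:
  assumes "a \<in> {1..n}" "b \<in> {1..n}" "a \<noteq> b"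
    and "p a = 0 \<or> (\<exists>j. p j = a)" "p b = 0 \<or> (\<exists>j. p j = b)"
  shows "nearly_disjoint (block p a) (block p b)"
  unfolding nearly_disjoint_def
proof
  fix i assume "i \<in> block p a \<inter> block p b"
  then consider "i = a" "p a = b" | "i = b" "p b = a"
    using assms(3) by (auto simp: block_def)
  then show "(i = Min (block p a) \<and> card (block p a) > 1 \<and> i \<noteq> Min (block p b)) \<or>
        (i \<noteq> Min (block p a) \<and> i = Min (block p b) \<and> card (block p b) > 1)"
    using assms Min_block card_block_gt_1 by cases auto
qed

lemma blocks_of_in_NCL: "blocks_of n p \<in> NCL n"
proof -
  have "\<Union> (blocks_of n p) = {1..n}"
  proof
    show "\<Union> (blocks_of n p) \<subseteq> {1..n}"
      unfolding blocks_of_def using block_subset by blast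
    show "{1..n} \<subseteq> \<Union> (blocks_of n p)"
    proof
      fix i assume i: "i \<in> {1..n}"
      show "i \<in> \<Union> (blocks_of n p)"
      proof (cases "p i = 0")
        case True
        with i show ?thesis
          by (auto simp: blocks_of_def block_def)
      next
        case False
        with i parent_fun_less[OF p, of i] have "p i \<in> {1..n}" by auto
        then show ?thesis
          by (auto simp: blocks_of_def block_def)
      qed
    qed
  qed
  moreover have "\<forall>E \<in> blocks_of n p. E \<noteq> {} \<and> E \<subseteq> {1..n}"
    unfolding blocks_of_def using block_subset by (auto simp: block_def)
  moreover have "\<forall>E \<in> blocks_of n p. \<forall>F \<in> blocks_of n p.
      E \<noteq> F \<longrightarrow> noncrossing E F \<and> nearly_disjoint E F"
  proof (intro ballI impI)
    fix E F assume "E \<in> blocks_of n p" "F \<in> blocks_of n p" "E \<noteq> F"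
    obtain a where a: "E = block p a" "a \<in> {1..n}" "p a = 0 \<or> (\<exists>j. p j = a)"
      using \<open>E \<in> blocks_of n p\<close> unfolding blocks_of_def by (elim imageE CollectE conjE)
    obtain b where b: "F = block p b" "b \<in> {1..n}" "p b = 0 \<or> (\<exists>j. p j = b)"
      using \<open>F \<in> blocks_of n p\<close> unfolding blocks_of_def by (elim imageE CollectE conjE)
    have "a \<noteq> b"
      using a(1) b(1) \<open>E \<noteq> F\<close> by auto
    then show "noncrossing E F \<and> nearly_disjoint E F"
      unfolding noncrossing_def a(1) b(1)
      by (intro conjI not_crossing_blocks nearly_disjoint_blocks a(2,3) b(2,3)) simp_all
  qed
  ultimately show ?thesis
    unfolding NCL_def by blast
qed

lemma parent_fun_eq_iff:
  assumes "m > 0"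
  shows "p j = m \<longleftrightarrow> (\<exists>E \<in> blocks_of n p. j \<in> E \<and> j \<noteq> Min E \<and> Min E = m)"
proof
  assume "p j = m"
  with assms have "m \<in> {1..n}" "j \<noteq> m"
    using parent_fun_less[OF p, of j] parent_fun_support[OF p, of j] by auto
  then have "block p m \<in> blocks_of n p" "j \<in> block p m" "Min (block p m) = m"
    using \<open>p j = m\<close> Min_block by (auto simp: blocks_of_def block_def)
  with \<open>j \<noteq> m\<close> show "\<exists>E \<in> blocks_of n p. j \<in> E \<and> j \<noteq> Min E \<and> Min E = m"
    by metis
next
  assume "\<exists>E \<in> blocks_of n p. j \<in> E \<and> j \<noteq> Min E \<and> Min E = m"
  then show "p j = m"
    using Min_block by (auto simp: blocks_of_def block_def)
qed

end

lemma inj_on_blocks_of: "inj_on (blocks_of n) (parent_funs n)"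
proof (rule inj_onI)
  fix p q assume pq: "p \<in> parent_funs n" "q \<in> parent_funs n" "blocks_of n p = blocks_of n q"
  then have "p j = m \<longleftrightarrow> q j = m" if "m > 0" for j m
    using parent_fun_eq_iff that by metis
  then show "p = q"
    by (metis ext neq0_conv)
qed

context
  fixes n \<pi>
  assumes \<pi>: "\<pi> \<in> NCL n"
begin

lemma NCL_block:
  assumes "E \<in> \<pi>"
  shows "finite E" "Min E \<in> E" "Min E \<in> {1..n}" "E \<subseteq> {1..n}"
    and "x \<in> E \<Longrightarrow> Min E \<le> x"
proof -
  show sub: "E \<subseteq> {1..n}" and fin: "finite E"
    using assms \<pi> finite_subset[of E "{1..n}"] by (auto simp: NCL_def)
  show "Min E \<in> E"
    using fin assms \<pi> by (intro Min_in) (auto simp: NCL_def)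
  then show "Min E \<in> {1..n}"
    using sub by blast
  show "x \<in> E \<Longrightarrow> Min E \<le> x"
    using fin by simp
qed

lemma NCL_nearly_disjoint:
  assumes "E \<in> \<pi>" "F \<in> \<pi>" "E \<noteq> F" "i \<in> E" "i \<in> F"
  shows "(i = Min E \<and> card E > 1 \<and> i \<noteq> Min F) \<or> (i \<noteq> Min E \<and> i = Min F \<and> card F > 1)"
  using assms \<pi> unfolding NCL_def nearly_disjoint_def by blast

lemma NCL_block_eq_if_Min_eq: "E \<in> \<pi> \<Longrightarrow> F \<in> \<pi> \<Longrightarrow> Min E = Min F \<Longrightarrow> E = F"
  using NCL_nearly_disjoint NCL_block(2) by metis

lemma NCL_block_eq_if_common_non_Min:
  "E \<in> \<pi> \<Longrightarrow> F \<in> \<pi> \<Longrightarrow> i \<in> E \<Longrightarrow> i \<in> F \<Longrightarrow> i \<noteq> Min E \<Longrightarrow> i \<noteq> Min F \<Longrightarrow> E = F"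
  using NCL_nearly_disjoint by metis

definition parent :: "nat \<Rightarrow> nat" where
  "parent j = (if \<exists>E \<in> \<pi>. j \<in> E \<and> j \<noteq> Min E
               then Min (SOME E. E \<in> \<pi> \<and> j \<in> E \<and> j \<noteq> Min E) else 0)"

lemma parent_eq:
  assumes "E \<in> \<pi>" "j \<in> E" "j \<noteq> Min E"
  shows "parent j = Min E"
proof -
  let ?P = "\<lambda>E. E \<in> \<pi> \<and> j \<in> E \<and> j \<noteq> Min E"
  have "?P (SOME E. ?P E)"
    using assms by (intro someI[of ?P E]) simp
  then have "(SOME E. ?P E) = E"
    using assms NCL_block_eq_if_common_non_Min by blast
  then show ?thesis
    unfolding parent_def using assms by auto
qed

lemma parent_posE:
  assumes "parent j > 0"
  obtains E where "E \<in> \<pi>" "j \<in> E" "j \<noteq> Min E" "parent j = Min E"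
proof -
  have "\<exists>E \<in> \<pi>. j \<in> E \<and> j \<noteq> Min E"
    using assms unfolding parent_def by (auto split: if_splits)
  then show ?thesis
    using parent_eq that by blast
qed

lemma parent_in_parent_funs: "parent \<in> parent_funs n"
proof -
  have "parent j = 0 \<or> parent j < j" for j
    using NCL_block(5)
    by (metis parent_posE gr0I order_le_imp_less_or_eq)
  moreover have "parent j = 0" if "j > n" for j
    using NCL_block(4) that
    by (metis parent_posE gr0I atLeastAtMost_iff leD subsetD)
  moreover have False
    if cr: "0 < parent i" "parent i < parent j" "parent j < i" "i < j" for i j
  proof -
    obtain E where E: "E \<in> \<pi>" "i \<in> E" "parent i = Min E"
      using cr parent_posE by blast
    obtain F where F: "F \<in> \<pi>" "j \<in> F" "parent j = Min F"
      using cr parent_posE by (metis less_trans)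
    have "crossing E F"
      unfolding crossing_def using E F cr NCL_block(2) by metis
    moreover have "E \<noteq> F"
      using E F cr by auto
    ultimately show False
      using \<pi> E F unfolding NCL_def noncrossing_def by blast
  qed
  ultimately show ?thesis
    unfolding parent_funs_def by blast
qed

lemma block_parent_Min:
  assumes "E \<in> \<pi>"
  shows "block parent (Min E) = E"
proof
  show "E \<subseteq> block parent (Min E)"
    using parent_eq[OF assms] by (auto simp: block_def)
  show "block parent (Min E) \<subseteq> E"
  proof
    fix j assume "j \<in> block parent (Min E)"
    moreover have "j \<in> E" if "parent j = Min E"
    proof -
      have "parent j > 0"
        using that NCL_block(3)[OF assms] by simp
      then obtain F where "F \<in> \<pi>" "j \<in> F" "parent j = Min F"
        by (rule parent_posE)
      then show ?thesis
        using that assms NCL_block_eq_if_Min_eq by metis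
    qed
    ultimately show "j \<in> E"
      using NCL_block(2)[OF assms] by (auto simp: block_def)
  qed
qed

lemma blocks_of_parent: "blocks_of n parent = \<pi>"
proof
  show "blocks_of n parent \<subseteq> \<pi>"
  proof
    fix B assume "B \<in> blocks_of n parent"
    then obtain m where m: "B = block parent m" "m \<in> {1..n}"
      "parent m = 0 \<or> (\<exists>j. parent j = m)"
      unfolding blocks_of_def by blast
    obtain F where F: "F \<in> \<pi>" "m \<in> F"
      using m(2) \<pi> unfolding NCL_def by blast
    have "\<exists>E \<in> \<pi>. Min E = m"
    proof (cases "parent m = 0")
      case True
      with F show ?thesis
        using parent_eq[of F m] NCL_block(3)[of F] by fastforce
    next
      case False
      with m obtain j where "parent j = m" by blast
      with m(2) show ?thesis
        using parent_posE[of j] by (metis atLeastAtMost_iff less_eq_Suc_le One_nat_def)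
    qed
    then show "B \<in> \<pi>"
      using m(1) block_parent_Min by metis
  qed
  show "\<pi> \<subseteq> blocks_of n parent"
  proof
    fix E assume E: "E \<in> \<pi>"
    have "parent (Min E) = 0 \<or> (\<exists>j. parent j = Min E)"
    proof (cases "E = {Min E}")
      case True
      (* A singleton block shares its element with no other block. *)
      then have "card E = 1"
        by (auto simp: card_1_singleton_iff)
      have "parent (Min E) = 0"
      proof (rule ccontr)
        assume "parent (Min E) \<noteq> 0"
        then obtain F where "F \<in> \<pi>" "Min E \<in> F" "Min E \<noteq> Min F"
          using parent_posE by (metis gr0I)
        then show False
          using NCL_nearly_disjoint[OF E, of F "Min E"] NCL_block(2)[OF E] \<open>card E = 1\<close> by auto
      qed
      then show ?thesis ..
    next
      case False
      then obtain j where "j \<in> E" "j \<noteq> Min E"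
        using NCL_block(2)[OF E] by blast
      then show ?thesis
        using parent_eq[OF E] by blast
    qed
    then show "E \<in> blocks_of n parent"
      unfolding blocks_of_def
      using block_parent_Min[OF E] NCL_block(3)[OF E] by (intro image_eqI[of _ _ "Min E"]) auto
  qed
qed

end

lemma bij_betw_blocks_of: "bij_betw (blocks_of n) (parent_funs n) (NCL n)"
  unfolding bij_betw_def
proof
  show "blocks_of n ` parent_funs n = NCL n"
    using blocks_of_in_NCL blocks_of_parent parent_in_parent_funs
    by (auto simp: image_iff) metis
qed (rule inj_on_blocks_of)

section \<open>Counting parent functions from left to right\<close>

text \<open>The vertices that may become the parent of \<open>n + 1\<close>.\<close>

definition open_vertices :: "nat \<Rightarrow> (nat \<Rightarrow> nat) \<Rightarrow> nat set" where
  "open_vertices n p = {v \<in> {1..n}. \<forall>i\<le>n. \<not> (0 < p i \<and> p i < v \<and> v < i)}"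

definition completions :: "nat \<Rightarrow> nat \<Rightarrow> (nat \<Rightarrow> nat) \<Rightarrow> (nat \<Rightarrow> nat) set" where
  "completions m n p = {q \<in> parent_funs (n + m). \<forall>j\<le>n. q j = p j}"

lemma finite_open_vertices: "finite (open_vertices n p)"
  by (rule finite_subset[of _ "{1..n}"]) (auto simp: open_vertices_def)

lemma extend_parent_fun:
  assumes "p \<in> parent_funs n" "v \<in> insert 0 (open_vertices n p)"
  shows "p(Suc n := v) \<in> parent_funs (Suc n)"
proof -
  let ?q = "p(Suc n := v)"
  have "?q j = 0 \<or> ?q j < j" for j
    using assms parent_fun_less[OF assms(1), of j] by (auto simp: open_vertices_def)
  moreover have "?q j = 0" if "j > Suc n" for j
    using that parent_fun_support[OF assms(1), of j] by fastforce
  moreover have False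
    if cr: "0 < ?q i" "?q i < ?q j" "?q j < i" "i < j" for i j
  proof -
    have "j \<le> Suc n"
      using cr parent_fun_support[OF assms(1), of j] by (cases "j = Suc n") auto
    with cr have i: "i \<le> n" "?q i = p i"
      by auto
    show False
    proof (cases "j = Suc n")
      case True
      with cr i assms(2) show False
        by (auto simp: open_vertices_def)
    next
      case False
      with cr i show False
        using parent_fun_noncrossing[OF assms(1), of i j] by simp
    qed
  qed
  ultimately show ?thesis
    unfolding parent_funs_def by blast
qed

lemma open_vertices_extend_root:
  "open_vertices (Suc n) (p(Suc n := 0)) = insert (Suc n) (open_vertices n p)"
  by (auto simp: open_vertices_def le_Suc_eq)

lemma open_vertices_extend_child:
  assumes "v \<in> open_vertices n p"
  shows "open_vertices (Suc n) (p(Suc n := v)) =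
    insert (Suc n) {u \<in> open_vertices n p. u \<le> v}"
  using assms by (auto simp: open_vertices_def le_Suc_eq not_less)

lemma completions_0: "p \<in> parent_funs n \<Longrightarrow> completions 0 n p = {p}"
  unfolding completions_def parent_funs_def
  by (auto intro!: ext) (metis leI)

lemma completions_Suc:
  "completions (Suc m) n p =
     (\<Union>v \<in> insert 0 (open_vertices n p). completions m (Suc n) (p(Suc n := v)))"
proof
  show "completions (Suc m) n p \<subseteq>
     (\<Union>v \<in> insert 0 (open_vertices n p). completions m (Suc n) (p(Suc n := v)))"
  proof
    fix q assume "q \<in> completions (Suc m) n p"
    then have q: "q \<in> parent_funs (n + Suc m)" "\<And>j. j \<le> n \<Longrightarrow> q j = p j"
      by (auto simp: completions_def)
    have "q (Suc n) \<in> insert 0 (open_vertices n p)"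
    proof (cases "q (Suc n) = 0")
      case False
      then have "q (Suc n) \<in> {1..n}"
        using parent_fun_less[OF q(1), of "Suc n"] by auto
      moreover have "\<not> (0 < p i \<and> p i < q (Suc n) \<and> q (Suc n) < i)" if "i \<le> n" for i
        using parent_fun_noncrossing[OF q(1), of i "Suc n"] q(2)[OF that] that by auto
      ultimately show ?thesis
        by (auto simp: open_vertices_def)
    qed simp
    moreover have "q \<in> completions m (Suc n) (p(Suc n := q (Suc n)))"
      using q by (auto simp: completions_def le_Suc_eq)
    ultimately show "q \<in> (\<Union>v \<in> insert 0 (open_vertices n p). completions m (Suc n) (p(Suc n := v)))"
      by blast
  qed
qed (force simp: completions_def)

lemma completions_disjoint:
  "v \<noteq> w \<Longrightarrow>
     completions m (Suc n) (p(Suc n := v)) \<inter> completions m (Suc n) (p(Suc n := w)) = {}"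
  by (auto simp: completions_def)

lemma finite_completions: "p \<in> parent_funs n \<Longrightarrow> finite (completions m n p)"
proof (induction m arbitrary: n p)
  case (Suc m)
  then show ?case
    unfolding completions_Suc using finite_open_vertices extend_parent_fun by blast
qed (simp add: completions_0)

lemma sum_over_ranks:
  fixes A :: "'a :: linorder set" and f :: "nat \<Rightarrow> 'b :: comm_monoid_add"
  assumes "finite A"
  shows "(\<Sum>v\<in>A. f (card {u \<in> A. u \<le> v})) = (\<Sum>t = 1..card A. f t)"
  using assms
proof (induction A rule: finite_linorder_max_induct)
  case (insert b A)
  have "b \<notin> A" using insert by auto
  have "{u \<in> insert b A. u \<le> v} = {u \<in> A. u \<le> v}" if "v \<in> A" for v
    using insert that by auto
  moreover have "{u \<in> insert b A. u \<le> b} = insert b A"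
    using insert by auto
  ultimately show ?case
    using insert \<open>b \<notin> A\<close> by (simp add: add.commute)
qed simp

text \<open>
  Making the new vertex a root corresponds to the single term of the recurrence; making it a child
  of the \<open>t\<close>-th open vertex leaves \<open>t + 1\<close> open vertices and corresponds to the summand \<open>t\<close>.
\<close>

lemma card_completions:
  assumes "p \<in> parent_funs n" "card (open_vertices n p) = Suc a"
  shows "real (card (completions m n p)) = fps_nth (completion_gf a) m"
  using assms
proof (induction m arbitrary: n p a)
  case 0
  then show ?case
    by (simp add: completions_0 completion_gf_nth_0)
next
  case (Suc m)
  let ?A = "open_vertices n p"
  let ?c = "\<lambda>v. real (card (completions m (Suc n) (p(Suc n := v))))"
  have fresh: "Suc n \<notin> ?A" and "0 \<notin> ?A"
    by (auto simp: open_vertices_def)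
  have "card (completions (Suc m) n p) =
      (\<Sum>v \<in> insert 0 ?A. card (completions m (Suc n) (p(Suc n := v))))"
    unfolding completions_Suc
    by (rule card_UN_disjoint)
      (use Suc.prems in \<open>auto simp del: insert_iff
         intro!: finite_completions extend_parent_fun completions_disjoint finite_open_vertices\<close>)
  then have "real (card (completions (Suc m) n p)) = ?c 0 + (\<Sum>v \<in> ?A. ?c v)"
    using \<open>0 \<notin> ?A\<close> by (simp add: finite_open_vertices)
  also have "?c 0 = fps_nth (completion_gf (Suc a)) m"
    using Suc.prems fresh
    by (intro Suc.IH extend_parent_fun)
      (auto simp: open_vertices_extend_root finite_open_vertices simp del: fun_upd_apply)
  also have "(\<Sum>v \<in> ?A. ?c v) =
      (\<Sum>v \<in> ?A. fps_nth (completion_gf (card {u \<in> ?A. u \<le> v})) m)"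
  proof (intro sum.cong refl Suc.IH)
    fix v assume v: "v \<in> ?A"
    then show "p(Suc n := v) \<in> parent_funs (Suc n)"
      using Suc.prems(1) by (intro extend_parent_fun) simp_all
    show "card (open_vertices (Suc n) (p(Suc n := v))) = Suc (card {u \<in> ?A. u \<le> v})"
      unfolding open_vertices_extend_child[OF v]
      using fresh finite_open_vertices by (intro card_insert_disjoint) auto
  qed
  also have "\<dots> = (\<Sum>t = 1..Suc a. fps_nth (completion_gf t) m)"
    unfolding Suc.prems(2)[symmetric]
    by (rule sum_over_ranks[where f = "\<lambda>t. fps_nth (completion_gf t) m"])
      (rule finite_open_vertices)
  finally show ?case
    by (simp only: completion_gf_nth_Suc)
qed

text \<open>The vertex \<open>1\<close> is always a root, so every parent function completes the zero function on \<open>{1}\<close>.\<close>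

lemma parent_funs_eq_completions: "parent_funs (n + 1) = completions n 1 (\<lambda>_. 0)"
proof -
  have "q j = 0" if "q \<in> parent_funs (n + 1)" "j \<le> 1" for q j
    using parent_fun_less[OF that(1), of j] that(2) by linarith
  then show ?thesis
    by (auto simp: completions_def)
qed

theorem theorem8p3:
  fixes n :: nat
  shows "real (card (NCL (n + 1))) = large_schroeder n"
proof -
  have "card (NCL (n + 1)) = card (completions n 1 (\<lambda>_. 0))"
    using bij_betw_same_card[OF bij_betw_blocks_of, of "n + 1"]
    by (simp only: parent_funs_eq_completions)
  also have "real \<dots> = fps_nth (completion_gf 0) n"
  proof (rule card_completions)
    have "open_vertices 1 (\<lambda>_. 0) = {1}"
      by (auto simp: open_vertices_def)
    then show "card (open_vertices 1 (\<lambda>_. 0)) = Suc 0"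
      by simp
  qed (simp add: parent_funs_def)
  also have "\<dots> = large_schroeder n"
    by (simp add: completion_gf_def large_schroeder_def)
  finally show ?thesis .
qed

end
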